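(* Let $1\leq p<\infty$ and let $E$ be a Hausdorff locally convex space. Then the space of continuous functions $C([0,1],E)$ is dense in $L^p([0,1],E)$.
   Context: All locally convex spaces are real. $\lambda$ is Lebesgue measure on $[0,1]$. A function $\gamma:[0,1]\to E$ is Lusin-measurable if for each $\varepsilon>0$ there is a compact $K_\varepsilon\subseteq[0,1]$ with $\lambda([0,1]\setminus K_\varepsilon)\leq\varepsilon$ and $\gamma|_{K_\varepsilon}$ continuous. $\mathcal{L}^p([0,1],E)$ is the set of Lusin-measurable $\gamma:[0,1]\to E$ such that $q\circ\gamma\in\mathcal{L}^p([0,1],\mathbb{R})$ for each continuous seminorm $q$ on $E$. $L^p([0,1],E)$ is its quotient by almost everywhere equality (a function is identified with its class), with the locally convex topology defined by the seminorms $\lVert\gamma\rVert_{\mathcal{L}^p,q}=\left(\int_0^1 q(\gamma(t))^p\,dt\right)^{1/p}$, where $q$ ranges over the continuous seminorms on $E$. *)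

theory Defs
  imports "HOL-Analysis.Analysis"
begin

section \<open>Locally convex spaces\<close>

class topological_real_vector = real_vector + topological_ab_group_add +
  assumes tendsto_scaleR_Pair_real:
    "LIM x (nhds a \<times>\<^sub>F nhds b). fst x *\<^sub>R snd x :> nhds (a *\<^sub>R b)"

text \<open>Not necessarily Hausdorff; add the sort \<^class>\<open>t2_space\<close> for that.\<close>

class locally_convex_space = topological_real_vector +
  assumes convex_nhds_0_raw:
    "open U \<Longrightarrow> 0 \<in> U \<Longrightarrow>
      \<exists>W V. open W \<and> 0 \<in> W \<and> W \<subseteq> V \<and> V \<subseteq> U \<and>
        (\<forall>x\<in>V. \<forall>y\<in>V. \<forall>u\<ge>0. \<forall>v\<ge>0. u + v = 1 \<longrightarrow> u *\<^sub>R x + v *\<^sub>R y \<in> V)"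

text \<open>The constants \<^const>\<open>convex\<close> and \<^const>\<open>interior\<close> cannot be used in the class
  specification itself, so they are unfolded there.\<close>

lemma convex_nhds_0:
  fixes U :: "'a::locally_convex_space set"
  assumes "open U" "0 \<in> U"
  shows "\<exists>V. convex V \<and> 0 \<in> interior V \<and> V \<subseteq> U"
  using convex_nhds_0_raw[OF assms] unfolding convex_def by (meson interiorI)

instance real_normed_vector \<subseteq> locally_convex_space
proof
  fix a :: real and b :: 'a
  show "LIM x (nhds a \<times>\<^sub>F nhds b). fst x *\<^sub>R snd x :> nhds (a *\<^sub>R b)"
    by (intro tendsto_scaleR filterlim_fst filterlim_snd)
next
  fix U :: "'a set"
  assume "open U" "0 \<in> U"
  then obtain e where e: "e > 0" "ball 0 e \<subseteq> U"
    using openE by blast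
  have "convex (ball (0::'a) e)"
    by simp
  with e show "\<exists>W V. open W \<and> 0 \<in> W \<and> W \<subseteq> V \<and> V \<subseteq> U \<and>
      (\<forall>x\<in>V. \<forall>y\<in>V. \<forall>u\<ge>0. \<forall>v\<ge>0. u + v = 1 \<longrightarrow> u *\<^sub>R x + v *\<^sub>R y \<in> V)"
    unfolding convex_def by (intro exI[of _ "ball 0 e"]) auto
qed

definition seminorm :: "('a::real_vector \<Rightarrow> real) \<Rightarrow> bool" where
  "seminorm q \<longleftrightarrow>
     (\<forall>x. 0 \<le> q x) \<and> (\<forall>x y. q (x + y) \<le> q x + q y) \<and> (\<forall>c x. q (c *\<^sub>R x) = \<bar>c\<bar> * q x)"

definition continuous_seminorm :: "('a::{real_vector,topological_space} \<Rightarrow> real) \<Rightarrow> bool" where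
  "continuous_seminorm q \<longleftrightarrow> seminorm q \<and> continuous_on UNIV q"


section \<open>Lebesgue spaces of vector-valued functions on the unit interval\<close>

text \<open>A function on \<open>[0,1]\<close> is represented by a total function on the reals. Everything below
  depends only on its restriction to \<open>[0,1]\<close>; in particular functions that agree on \<open>[0,1]\<close>
  belong to the same class in \<open>Lp_space\<close>.\<close>

definition Lusin_measurable :: "(real \<Rightarrow> 'a::topological_space) \<Rightarrow> bool" where
  "Lusin_measurable \<gamma> \<longleftrightarrow>
     (\<forall>\<epsilon>>0. \<exists>K. compact K \<and> K \<subseteq> {0..1} \<and> emeasure lebesgue ({0..1} - K) \<le> ennreal \<epsilon> \<and>
        continuous_on K \<gamma>)"

definition scalar_Lp_functions :: "real \<Rightarrow> (real \<Rightarrow> real) set" where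
  "scalar_Lp_functions p =
     {f. f \<in> borel_measurable (lebesgue_on {0..1}) \<and>
         integrable (lebesgue_on {0..1}) (\<lambda>t. \<bar>f t\<bar> powr p)}"

definition Lp_functions :: "real \<Rightarrow> (real \<Rightarrow> 'a::locally_convex_space) set" where
  "Lp_functions p =
     {\<gamma>. Lusin_measurable \<gamma> \<and> (\<forall>q. continuous_seminorm q \<longrightarrow> q \<circ> \<gamma> \<in> scalar_Lp_functions p)}"

definition Lp_rel :: "real \<Rightarrow> ((real \<Rightarrow> 'a::locally_convex_space) \<times> (real \<Rightarrow> 'a)) set" where
  "Lp_rel p = {(\<gamma>, \<eta>). \<gamma> \<in> Lp_functions p \<and> \<eta> \<in> Lp_functions p \<and>
                        (AE t in lebesgue_on {0..1}. \<gamma> t = \<eta> t)}"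

lemma equiv_Lp_rel: "equiv (Lp_functions p) (Lp_rel p)"
proof (rule equivI)
  show "sym (Lp_rel p)"
    by (auto simp: sym_def Lp_rel_def)
  show "trans (Lp_rel p)"
    unfolding trans_def Lp_rel_def by auto
qed (auto simp: refl_on_def Lp_rel_def)

definition Lp_space :: "real \<Rightarrow> (real \<Rightarrow> 'a::locally_convex_space) set set" where
  "Lp_space p = Lp_functions p // Lp_rel p"

definition Lp_seminorm ::
    "real \<Rightarrow> ('a \<Rightarrow> real) \<Rightarrow> (real \<Rightarrow> 'a::locally_convex_space) \<Rightarrow> real" where
  "Lp_seminorm p q \<gamma> = (\<integral>t. q (\<gamma> t) powr p \<partial>lebesgue_on {0..1}) powr (1 / p)"

text \<open>The seminorm of a difference of classes does not depend on the representatives, so the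
  existential quantifiers below could equally well be universal.\<close>

definition Lp_ball ::
    "real \<Rightarrow> ('a \<Rightarrow> real) \<Rightarrow> (real \<Rightarrow> 'a::locally_convex_space) set \<Rightarrow> real
      \<Rightarrow> (real \<Rightarrow> 'a) set set" where
  "Lp_ball p q X \<epsilon> =
     {Y \<in> Lp_space p. \<exists>\<gamma>\<in>X. \<exists>\<eta>\<in>Y. Lp_seminorm p q (\<lambda>t. \<eta> t - \<gamma> t) < \<epsilon>}"

definition Lp_topology :: "real \<Rightarrow> (real \<Rightarrow> 'a::locally_convex_space) set topology" where
  "Lp_topology p = topology_generated_by
     {Lp_ball p q X \<epsilon> | q X \<epsilon>. continuous_seminorm q \<and> X \<in> Lp_space p \<and> \<epsilon> > 0}"

lemma topspace_Lp_topology: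
  "topspace (Lp_topology p :: (real \<Rightarrow> 'a::locally_convex_space) set topology) = Lp_space p"
proof -
  let ?B = "{Lp_ball p q X \<epsilon> | (q :: 'a \<Rightarrow> real) X \<epsilon>.
               continuous_seminorm q \<and> X \<in> Lp_space p \<and> \<epsilon> > 0}"
  have "X \<in> \<Union>?B" if X: "X \<in> Lp_space p" for X
  proof -
    obtain \<gamma> where \<gamma>: "\<gamma> \<in> X"
      using X equiv_Lp_rel in_quotient_imp_non_empty unfolding Lp_space_def by blast
    have "Lp_seminorm p (\<lambda>_. 0) (\<lambda>t. \<gamma> t - \<gamma> t) < 1"
      by (simp add: Lp_seminorm_def)
    with \<gamma> X have "X \<in> Lp_ball p (\<lambda>_. 0) X 1"
      unfolding Lp_ball_def by blast
    moreover have "continuous_seminorm (\<lambda>_::'a. 0)"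
      by (simp add: continuous_seminorm_def seminorm_def)
    ultimately show ?thesis
      using X zero_less_one by blast
  qed
  moreover have "\<Union>?B \<subseteq> Lp_space p"
    by (auto simp: Lp_ball_def)
  ultimately show ?thesis
    unfolding Lp_topology_def topology_generated_by_topspace by blast
qed

text \<open>The classes of the functions that are continuous on \<open>[0,1]\<close>. If such a function were not
  in \<open>Lp_functions p\<close>, its image under \<open>Lp_rel p\<close> would be empty and so not an element of
  \<open>Lp_space p\<close>.\<close>

definition continuous_classes :: "real \<Rightarrow> (real \<Rightarrow> 'a::locally_convex_space) set set" where
  "continuous_classes p = {Lp_rel p `` {\<gamma>} | \<gamma>. continuous_on {0..1} \<gamma>}"

end

theory Submission
  imports Defs
begin

text \<open>Minkowski's inequality shows that every neighbourhood of a class contains a ball around that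
  class for a single continuous seminorm \<open>q\<close>, so it suffices to approximate \<open>\<gamma>\<close> with respect to
  one \<open>q\<close>. Composing \<open>\<gamma>\<close> with the continuous radial truncation \<open>x \<mapsto> (N / max N (q x)) x\<close> and
  letting \<open>N\<close> tend to infinity reduces this, by dominated convergence, to the case \<open>q \<circ> \<gamma> \<le> N\<close>. Then
  \<open>\<gamma>\<close> is continuous on a compact set \<open>K\<close> whose complement is small compared with \<open>N\<close>, and a
  partition of unity yields a continuous function that is \<open>q\<close>-close to \<open>\<gamma>\<close> on \<open>K\<close> and still
  satisfies the bound \<open>N\<close> everywhere.\<close>

section \<open>Minkowski's inequality\<close>

text \<open>If an argument is 0, the claim reduces to
  \<open>(c * z) powr p \<le> c * z powr p\<close>, which holds because
  \<open>c powr p \<le> c\<close> for \<open>0 < c < 1\<close>. The endpoint 0 has to be included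
  because the functions in Minkowski's inequality may vanish.\<close>

lemma convex_on_powr_nonneg:
  assumes "1 \<le> (p::real)"
  shows "convex_on {0..} (\<lambda>x. x powr p)"
proof (rule convex_onI)
  fix t x y :: real
  assume t: "0 < t" "t < 1" and xy: "x \<in> {0..}" "y \<in> {0..}"
  have scale: "(c * z) powr p \<le> c * z powr p" if "0 < c" "c < 1" "0 \<le> z" for c z :: real
    using that assms powr_mono'[of 1 p c] by (auto simp: powr_mult intro!: mult_right_mono)
  show "((1 - t) *\<^sub>R x + t *\<^sub>R y) powr p \<le> (1 - t) * x powr p + t * y powr p"
  proof (cases "x = 0 \<or> y = 0")
    case True
    then show ?thesis
      using scale[of "1 - t" x] scale[of t y] t xy by auto
  next
    case False
    then show ?thesis
      using convex_onD[OF powr_convex[OF assms], of t x y] t xy by auto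
  qed
qed simp

text \<open>\<open>(x + y) / (a + b)\<close> is the convex combination of \<open>x / a\<close> and
  \<open>y / b\<close> with weights \<open>a / (a + b)\<close> and \<open>b / (a + b)\<close>.
  Bounds on the two norms as \<open>a\<close> and \<open>b\<close> lead to Minkowski's inequality;
  \<open>a = b = 1\<close> leads to integrability of differences.\<close>

lemma add_powr_le:
  fixes p :: real
  assumes "1 \<le> p" "0 \<le> x" "0 \<le> y" "0 < a" "0 < b"
  shows "(x + y) powr p \<le>
    (a + b) powr p * (a / (a + b) * (x / a) powr p + b / (a + b) * (y / b) powr p)"
proof -
  let ?t = "b / (a + b)"
  have t: "1 - ?t = a / (a + b)"
    using assms by (simp add: field_simps)
  have "(a / (a + b) * (x / a) + ?t * (y / b)) powr p
      \<le> a / (a + b) * (x / a) powr p + ?t * (y / b) powr p"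
    using convex_onD[OF convex_on_powr_nonneg[OF assms(1)], of ?t "x / a" "y / b"] assms
    unfolding t by simp
  moreover have "x + y = (a + b) * (a / (a + b) * (x / a) + ?t * (y / b))"
  proof -
    have "a / (a + b) * (x / a) = x / (a + b)" "?t * (y / b) = y / (a + b)"
      using assms by auto
    then show ?thesis
      using assms by (simp add: add_divide_distrib[symmetric])
  qed
  moreover have "0 \<le> a / (a + b) * (x / a) + ?t * (y / b)"
    using assms by simp
  ultimately show ?thesis
    using assms by (metis add_nonneg_nonneg less_imp_le mult_left_mono powr_ge_zero powr_mult)
qed

text \<open>Integrate \<open>add_powr_le\<close> with \<open>a\<close> and \<open>b\<close> slightly
  above the norms of \<open>f\<close> and \<open>g\<close>: both normalised integrals are then at
  most 1, and the weights add up to 1.\<close>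

lemma Minkowski_integral:
  fixes f g h :: "'a \<Rightarrow> real"
  assumes p: "1 \<le> p"
    and f: "integrable M (\<lambda>x. f x powr p)" and g: "integrable M (\<lambda>x. g x powr p)"
    and nonneg: "\<And>x. x \<in> space M \<Longrightarrow> 0 \<le> f x" "\<And>x. x \<in> space M \<Longrightarrow> 0 \<le> g x"
      "\<And>x. x \<in> space M \<Longrightarrow> 0 \<le> h x"
    and le: "\<And>x. x \<in> space M \<Longrightarrow> h x \<le> f x + g x"
  shows "(\<integral>x. h x powr p \<partial>M) powr (1 / p)
    \<le> (\<integral>x. f x powr p \<partial>M) powr (1 / p) + (\<integral>x. g x powr p \<partial>M) powr (1 / p)"
    (is "?H \<le> ?F + ?G")
proof (rule field_le_epsilon)
  fix e :: real assume e: "0 < e"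
  \<comment> \<open>The summand \<open>e / 2\<close> keeps the divisors \<open>a\<close> and
    \<open>b\<close> positive even if a norm is 0.\<close>
  define a where "a = ?F + e / 2"
  define b where "b = ?G + e / 2"
  have ab: "0 < a" "0 < b"
    unfolding a_def b_def using e by (auto intro: add_nonneg_pos)
  have root: "(c powr (1 / p)) powr p = c" if "0 \<le> c" for c :: real
    using that p by (simp add: powr_powr)
  have "?F powr p \<le> a powr p" "?G powr p \<le> b powr p"
    using p e unfolding a_def b_def by (auto intro!: powr_mono2)
  then have int_le: "(\<integral>x. f x powr p \<partial>M) \<le> a powr p" "(\<integral>x. g x powr p \<partial>M) \<le> b powr p"
    by (simp_all add: root integral_nonneg_AE)
  \<comment> \<open>Dividing by a bound \<open>c\<close> on the norm brings the integral down to at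
    most 1. Nonnegativity of \<open>k\<close> is known only on \<open>space M\<close>, so
    \<open>c\<close> is pulled out by congruence rules.\<close>
  have scaled: "integrable M (\<lambda>x. (k x / c) powr p) \<and> (\<integral>x. (k x / c) powr p \<partial>M) \<le> 1"
    if "0 < c" "integrable M (\<lambda>x. k x powr p)" "\<And>x. x \<in> space M \<Longrightarrow> 0 \<le> k x"
      "(\<integral>x. k x powr p \<partial>M) \<le> c powr p" for k :: "'a \<Rightarrow> real" and c
  proof -
    have eq: "(k x / c) powr p = k x powr p / c powr p" if "x \<in> space M" for x
      using that \<open>0 < c\<close> by (simp add: powr_divide)
    have "integrable M (\<lambda>x. (k x / c) powr p) \<longleftrightarrow> integrable M (\<lambda>x. k x powr p / c powr p)"
      by (intro Bochner_Integration.integrable_cong refl eq)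
    moreover have "(\<integral>x. (k x / c) powr p \<partial>M) = (\<integral>x. k x powr p / c powr p \<partial>M)"
      by (intro Bochner_Integration.integral_cong refl eq)
    ultimately show ?thesis
      using that by simp
  qed
  have intf: "integrable M (\<lambda>x. (f x / a) powr p)" and f1: "(\<integral>x. (f x / a) powr p \<partial>M) \<le> 1"
    using scaled[OF ab(1) f nonneg(1) int_le(1)] by auto
  have intg: "integrable M (\<lambda>x. (g x / b) powr p)" and g1: "(\<integral>x. (g x / b) powr p \<partial>M) \<le> 1"
    using scaled[OF ab(2) g nonneg(2) int_le(2)] by auto
  have "(\<integral>x. h x powr p \<partial>M)
      \<le> (\<integral>x. (a + b) powr p * (a / (a + b) * (f x / a) powr p + b / (a + b) * (g x / b) powr p) \<partial>M)"
  \<comment> \<open>A non-integrable function has integral 0, so only the majorant must be shown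
    integrable and nonnegative.\<close>
  proof (rule integral_mono')
    show "integrable M (\<lambda>x. (a + b) powr p *
        (a / (a + b) * (f x / a) powr p + b / (a + b) * (g x / b) powr p))"
      using intf intg by simp
    fix x assume x: "x \<in> space M"
    have "h x powr p \<le> (f x + g x) powr p"
      using x nonneg le p by (intro powr_mono2) auto
    also have "\<dots> \<le> (a + b) powr p *
        (a / (a + b) * (f x / a) powr p + b / (a + b) * (g x / b) powr p)"
      using x nonneg ab p by (intro add_powr_le) auto
    finally show "h x powr p \<le> (a + b) powr p *
        (a / (a + b) * (f x / a) powr p + b / (a + b) * (g x / b) powr p)" .
    then show "0 \<le> (a + b) powr p *
        (a / (a + b) * (f x / a) powr p + b / (a + b) * (g x / b) powr p)"
      by (rule order_trans[rotated]) simp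
  qed
  also have "\<dots> = (a + b) powr p * (a / (a + b) * (\<integral>x. (f x / a) powr p \<partial>M)
      + b / (a + b) * (\<integral>x. (g x / b) powr p \<partial>M))"
    using intf intg by simp
  also have "\<dots> \<le> (a + b) powr p * (a / (a + b) * 1 + b / (a + b) * 1)"
    using f1 g1 ab by (intro mult_left_mono add_mono) auto
  also have "\<dots> = (a + b) powr p"
    using ab by (simp add: add_divide_distrib[symmetric])
  finally have "?H \<le> ((a + b) powr p) powr (1 / p)"
    using p by (intro powr_mono2) (auto intro!: integral_nonneg_AE)
  also have "\<dots> = a + b"
    using ab p by (simp add: powr_powr)
  also have "\<dots> = ?F + ?G + e"
    by (simp add: a_def b_def)
  finally show "?H \<le> ?F + ?G + e" .
qed

section \<open>Continuous seminorms and Lusin measurability\<close>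

lemma continuous_on_scaleR_tvs:
  fixes g :: "'b::topological_space \<Rightarrow> 'a::topological_real_vector"
  assumes "continuous_on S f" "continuous_on S g"
  shows "continuous_on S (\<lambda>x. f x *\<^sub>R g x)"
  unfolding continuous_on_def
proof
  fix x assume "x \<in> S"
  then have "(f \<longlongrightarrow> f x) (at x within S)" "(g \<longlongrightarrow> g x) (at x within S)"
    using assms by (auto simp: continuous_on_def)
  from filterlim_compose[OF tendsto_scaleR_Pair_real filterlim_Pair[OF this]]
  show "((\<lambda>x. f x *\<^sub>R g x) \<longlongrightarrow> f x *\<^sub>R g x) (at x within S)"
    by simp
qed

lemma continuous_seminormD:
  assumes "continuous_seminorm q"
  shows seminorm_nonneg: "0 \<le> q x"
    and seminorm_triangle: "q (x + y) \<le> q x + q y"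
    and seminorm_scaleR: "q (c *\<^sub>R x) = \<bar>c\<bar> * q x"
    and seminorm_zero: "q 0 = 0"
    and seminorm_diff_le: "q (x - y) \<le> q x + q y"
    and continuous_on_seminorm: "continuous_on S g \<Longrightarrow> continuous_on S (\<lambda>x. q (g x))"
proof -
  have sn: "seminorm q" and c: "continuous_on UNIV q"
    using assms by (auto simp: continuous_seminorm_def)
  show *: "0 \<le> q x" "q (x + y) \<le> q x + q y" "q (c *\<^sub>R x) = \<bar>c\<bar> * q x" for x y c
    using sn by (auto simp: seminorm_def)
  show "q 0 = 0"
    using *(3)[of 0 0] by simp
  show "q (x - y) \<le> q x + q y"
    using *(2)[of x "- y"] *(3)[of "-1" y] by simp
  show "continuous_on S (\<lambda>x. q (g x))" if "continuous_on S g"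
    using that c by (auto intro: continuous_on_compose2)
qed

lemma seminorm_sum:
  assumes "continuous_seminorm q"
  shows "q (sum f A) \<le> (\<Sum>x\<in>A. q (f x))"
proof (induction A rule: infinite_finite_induct)
  case (insert x A)
  then show ?case
    using seminorm_triangle[OF assms, of "f x" "sum f A"] by simp
\<comment> \<open>Over an infinite set both sums are 0 by convention, as over the empty set.\<close>
qed (simp_all add: seminorm_zero[OF assms])

text \<open>Makes the family of continuous seminorms directed: the sum dominates both summands, so
  finite intersections of balls contain a ball for a single seminorm.\<close>

lemma continuous_seminorm_add:
  assumes "continuous_seminorm q" "continuous_seminorm r"
  shows "continuous_seminorm (\<lambda>x. q x + r x)"
  unfolding continuous_seminorm_def seminorm_def
proof (intro conjI allI)
  fix x y c
  show "0 \<le> q x + r x"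
    using assms by (intro add_nonneg_nonneg seminorm_nonneg)
  show "q (x + y) + r (x + y) \<le> q x + r x + (q y + r y)"
    using seminorm_triangle[OF assms(1), of x y] seminorm_triangle[OF assms(2), of x y] by linarith
  show "q (c *\<^sub>R x) + r (c *\<^sub>R x) = \<bar>c\<bar> * (q x + r x)"
    using assms by (simp add: seminorm_scaleR distrib_left)
  show "continuous_on UNIV (\<lambda>x. q x + r x)"
    using assms by (intro continuous_on_add) (auto simp: continuous_seminorm_def)
qed

section \<open>Lusin measurability\<close>

lemma Lusin_measurableE:
  assumes "Lusin_measurable \<gamma>" "0 < \<epsilon>"
  obtains K where "compact K" "K \<subseteq> {0..1}" "emeasure lebesgue ({0..1} - K) \<le> ennreal \<epsilon>"
    "continuous_on K \<gamma>"
  using assms unfolding Lusin_measurable_def by blast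

lemma continuous_on_imp_Lusin_measurable:
  "continuous_on {0..1} \<gamma> \<Longrightarrow> Lusin_measurable \<gamma>"
  unfolding Lusin_measurable_def by (auto intro!: exI[of _ "{0..1}"])

lemma Lusin_measurable_compose:
  assumes "Lusin_measurable \<gamma>" "continuous_on UNIV f"
  shows "Lusin_measurable (\<lambda>t. f (\<gamma> t))"
proof -
  have "continuous_on K (\<lambda>t. f (\<gamma> t))" if "continuous_on K \<gamma>" for K
    using continuous_on_compose2[OF assms(2) that] by simp
  then show ?thesis
    using assms(1) unfolding Lusin_measurable_def by meson
qed

text \<open>Both functions are continuous on the intersection of compact sets chosen for
  \<open>\<epsilon> / 2\<close>, and the measures of the complements add.\<close>

lemma Lusin_measurable_diff:
  fixes \<gamma> \<eta> :: "real \<Rightarrow> 'a::topological_ab_group_add"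
  assumes "Lusin_measurable \<gamma>" "Lusin_measurable \<eta>"
  shows "Lusin_measurable (\<lambda>t. \<gamma> t - \<eta> t)"
  unfolding Lusin_measurable_def
proof (intro allI impI)
  fix \<epsilon> :: real assume "0 < \<epsilon>"
  then have e: "0 < \<epsilon> / 2" by simp
  obtain K where K: "compact K" "K \<subseteq> {0..1}" "emeasure lebesgue ({0..1} - K) \<le> ennreal (\<epsilon> / 2)"
    "continuous_on K \<gamma>"
    using Lusin_measurableE[OF assms(1) e] .
  obtain L where L: "compact L" "L \<subseteq> {0..1}" "emeasure lebesgue ({0..1} - L) \<le> ennreal (\<epsilon> / 2)"
    "continuous_on L \<eta>"
    using Lusin_measurableE[OF assms(2) e] .
  have sets: "{0..1} - K \<in> sets lebesgue" "{0..1} - L \<in> sets lebesgue"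
    using K L by (auto simp: compact_imp_closed)
  have "emeasure lebesgue ({0..1} - K \<inter> L)
      = emeasure lebesgue (({0..1} - K) \<union> ({0..1} - L))"
    by (simp add: Diff_Int)
  also have "\<dots> \<le> emeasure lebesgue ({0..1} - K) + emeasure lebesgue ({0..1} - L)"
    using sets by (rule emeasure_subadditive)
  also have "\<dots> \<le> ennreal (\<epsilon> / 2) + ennreal (\<epsilon> / 2)"
    using K L by (intro add_mono)
  also have "\<dots> = ennreal \<epsilon>"
    using e by (simp flip: ennreal_plus)
  finally show "\<exists>K. compact K \<and> K \<subseteq> {0..1} \<and> emeasure lebesgue ({0..1} - K) \<le> ennreal \<epsilon> \<and>
      continuous_on K (\<lambda>t. \<gamma> t - \<eta> t)"
    using K L by (intro exI[of _ "K \<inter> L"])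
      (auto intro!: continuous_on_diff compact_Int intro: continuous_on_subset)
qed

text \<open>Countably many compact sets on which \<open>f\<close> is continuous exhaust the unit
  interval up to a null set \<open>R\<close>; preimages of open sets are measurable on each
  piece.\<close>

lemma Lusin_measurable_imp_borel_measurable:
  fixes f :: "real \<Rightarrow> real"
  assumes "Lusin_measurable f"
  shows "f \<in> borel_measurable (lebesgue_on {0..1})"
proof -
  have "\<exists>K. compact K \<and> K \<subseteq> {0..1} \<and> emeasure lebesgue ({0..1} - K) \<le> ennreal (1 / Suc n) \<and>
      continuous_on K f" for n
    using assms unfolding Lusin_measurable_def by simp
  then obtain K where K: "\<And>n. compact (K n)" "\<And>n. K n \<subseteq> {0..1}"
    "\<And>n. emeasure lebesgue ({0..1} - K n) \<le> ennreal (1 / Suc n)" "\<And>n. continuous_on (K n) f"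
    by metis
  have K_sets [measurable]: "K n \<in> sets lebesgue" for n
    using K(1) by (simp add: compact_imp_closed)
  define R where "R = {0..1} - (\<Union>n. K n)"
  have R_sets: "R \<in> sets lebesgue"
    unfolding R_def using K_sets by (intro sets.Diff sets.countable_UN) auto
  have "emeasure lebesgue R \<le> ennreal (1 / Suc n)" for n
    using K_sets by (intro order_trans[OF emeasure_mono K(3)[of n]]) (auto simp: R_def)
  moreover have "(\<lambda>n. ennreal (1 / Suc n)) \<longlonglongrightarrow> ennreal 0"
    by (intro tendsto_ennrealI LIMSEQ_Suc lim_1_over_n)
  ultimately have "emeasure lebesgue R \<le> 0"
    by (intro LIMSEQ_le_const[of "\<lambda>n. ennreal (1 / Suc n)"]) auto
  then have null: "R \<in> null_sets lebesgue"
    using R_sets by auto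
  have "{t \<in> {0..1}. f t \<in> T} \<in> sets (lebesgue_on {0..1})" if "open T" for T
  proof -
    have "{t \<in> K n. f t \<in> T} \<in> sets lebesgue" for n
    proof -
      have "{t \<in> K n. f t \<in> T} \<in> sets (lebesgue_on (K n))"
        using continuous_imp_measurable_on_sets_lebesgue[OF K(4) K_sets] that
        unfolding borel_measurable_vimage_open by blast
      then show ?thesis
        using K_sets by (simp add: sets_restrict_space_iff)
    qed
    \<comment> \<open>Lebesgue measure is complete, so every subset of the null set \<open>R\<close>
      is measurable, whatever \<open>f\<close> does there.\<close>
    moreover have "{t \<in> R. f t \<in> T} \<in> sets lebesgue"
      using null_sets_completion_subset[OF _ null, of "{t \<in> R. f t \<in> T}"] by blast
    ultimately have "(\<Union>n. {t \<in> K n. f t \<in> T}) \<union> {t \<in> R. f t \<in> T} \<in> sets lebesgue"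
      by blast
    also have "(\<Union>n. {t \<in> K n. f t \<in> T}) \<union> {t \<in> R. f t \<in> T} = {t \<in> {0..1}. f t \<in> T}"
      using K(2)[THEN subsetD] by (auto simp: R_def simp del: atLeastAtMost_iff)
    finally show ?thesis
      by (auto simp: sets_restrict_space_iff)
  qed
  then show ?thesis
    unfolding borel_measurable_vimage_open by blast
qed

lemma Lusin_measurable_seminorm_measurable:
  assumes "Lusin_measurable \<gamma>" "continuous_seminorm q"
  shows "(\<lambda>t. q (\<gamma> t)) \<in> borel_measurable (lebesgue_on {0..1})"
  using Lusin_measurable_compose[OF assms(1), of q] assms(2)
  by (auto simp: continuous_seminorm_def intro: Lusin_measurable_imp_borel_measurable)

section \<open>The space \<open>Lp_functions\<close> and its seminorms\<close>

text \<open>Lusin measurability of \<open>\<gamma>\<close> yields measurability of each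
  \<open>q \<circ> \<gamma>\<close>, and the absolute value disappears because seminorms are
  nonnegative.\<close>

lemma Lp_functions_iff:
  "\<gamma> \<in> Lp_functions p \<longleftrightarrow> Lusin_measurable \<gamma> \<and>
    (\<forall>q. continuous_seminorm q \<longrightarrow> integrable (lebesgue_on {0..1}) (\<lambda>t. q (\<gamma> t) powr p))"
  by (auto simp: Lp_functions_def scalar_Lp_functions_def comp_def seminorm_nonneg
      Lusin_measurable_seminorm_measurable)

lemma seminorm_Lp_measurable:
  assumes "\<gamma> \<in> Lp_functions p" "continuous_seminorm q"
  shows "(\<lambda>t. q (\<gamma> t)) \<in> borel_measurable (lebesgue_on {0..1})"
  using assms by (simp add: Lp_functions_def scalar_Lp_functions_def comp_def)

text \<open>The common membership test for differences, continuous functions and truncations; the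
  majorant may depend on the seminorm.\<close>

lemma Lp_functions_dominated:
  assumes \<gamma>: "Lusin_measurable \<gamma>"
    and bound: "\<And>q. continuous_seminorm q \<Longrightarrow> \<exists>g. integrable (lebesgue_on {0..1}) g \<and>
      (\<forall>t\<in>{0..1}. q (\<gamma> t) powr p \<le> g t)"
  shows "\<gamma> \<in> Lp_functions p"
  unfolding Lp_functions_iff
proof (intro conjI allI impI)
  fix q :: "'a \<Rightarrow> real" assume q: "continuous_seminorm q"
  obtain g where g: "integrable (lebesgue_on {0..1}) g" "\<And>t. t \<in> {0..1} \<Longrightarrow> q (\<gamma> t) powr p \<le> g t"
    using bound[OF q] by blast
  have [measurable]: "(\<lambda>t. q (\<gamma> t)) \<in> borel_measurable (lebesgue_on {0..1})"
    using \<gamma> q by (rule Lusin_measurable_seminorm_measurable)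
  show "integrable (lebesgue_on {0..1}) (\<lambda>t. q (\<gamma> t) powr p)"
    using g(2) by (intro Bochner_Integration.integrable_bound[OF g(1)] AE_I2)
      (auto intro: order_trans[OF _ abs_ge_self])
qed fact

lemma Lp_functions_diff:
  assumes p: "1 \<le> p" and "\<gamma> \<in> Lp_functions p" "\<eta> \<in> Lp_functions p"
  shows "(\<lambda>t. \<gamma> t - \<eta> t) \<in> Lp_functions p"
proof (rule Lp_functions_dominated)
  show "Lusin_measurable (\<lambda>t. \<gamma> t - \<eta> t)"
    using assms by (simp add: Lp_functions_iff Lusin_measurable_diff)
  fix q :: "'a \<Rightarrow> real" assume q: "continuous_seminorm q"
  \<comment> \<open>This is the bound of \<open>add_powr_le\<close> with
    \<open>a = b = 1\<close>.\<close>
  let ?g = "\<lambda>t. 2 powr p * (1 / 2 * q (\<gamma> t) powr p + 1 / 2 * q (\<eta> t) powr p)"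
  have "integrable (lebesgue_on {0..1}) ?g"
    using assms q by (simp add: Lp_functions_iff)
  moreover have "q (\<gamma> t - \<eta> t) powr p \<le> ?g t" for t
  proof -
    have "q (\<gamma> t - \<eta> t) powr p \<le> (q (\<gamma> t) + q (\<eta> t)) powr p"
      using p by (intro powr_mono2) (auto simp: seminorm_nonneg[OF q] seminorm_diff_le[OF q])
    also have "\<dots> \<le> ?g t"
      using add_powr_le[OF p seminorm_nonneg[OF q] seminorm_nonneg[OF q], of 1 1] by simp
    finally show ?thesis .
  qed
  ultimately show "\<exists>g. integrable (lebesgue_on {0..1}) g \<and>
      (\<forall>t\<in>{0..1}. q (\<gamma> t - \<eta> t) powr p \<le> g t)"
    by blast
qed

text \<open>Each \<open>q \<circ> \<gamma>\<close> is bounded on the compact interval, and constants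
  are integrable over a finite measure.\<close>

lemma continuous_imp_Lp_functions:
  assumes p: "1 \<le> p" and \<gamma>: "continuous_on {0..1} \<gamma>"
  shows "\<gamma> \<in> Lp_functions p"
proof (rule Lp_functions_dominated)
  show "Lusin_measurable \<gamma>"
    using \<gamma> by (rule continuous_on_imp_Lusin_measurable)
  fix q :: "'a \<Rightarrow> real" assume q: "continuous_seminorm q"
  have "compact ((\<lambda>t. q (\<gamma> t)) ` {0..1})"
    using \<gamma> by (intro compact_continuous_image continuous_on_seminorm[OF q] compact_Icc)
  then have "bdd_above ((\<lambda>t. q (\<gamma> t)) ` {0..1})"
    by (intro bounded_imp_bdd_above compact_imp_bounded)
  then obtain B where B: "\<And>t. t \<in> {0..1} \<Longrightarrow> q (\<gamma> t) \<le> B"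
    unfolding bdd_above_def by blast
  have "q (\<gamma> t) powr p \<le> B powr p" if "t \<in> {0..1}" for t
    using p B[OF that] by (intro powr_mono2) (auto simp: seminorm_nonneg[OF q])
  moreover have "integrable (lebesgue_on {0..1}) (\<lambda>_::real. B powr p)"
    by (intro finite_measure.integrable_const finite_measure_lebesgue_on) auto
  ultimately show "\<exists>g. integrable (lebesgue_on {0..1}) g \<and> (\<forall>t\<in>{0..1}. q (\<gamma> t) powr p \<le> g t)"
    by blast
qed

lemma Lp_seminorm_triangle:
  assumes p: "1 \<le> p" and q: "continuous_seminorm q"
    and L: "\<gamma> \<in> Lp_functions p" "\<eta> \<in> Lp_functions p" "\<zeta> \<in> Lp_functions p"
  shows "Lp_seminorm p q (\<lambda>t. \<gamma> t - \<zeta> t)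
    \<le> Lp_seminorm p q (\<lambda>t. \<gamma> t - \<eta> t) + Lp_seminorm p q (\<lambda>t. \<eta> t - \<zeta> t)"
  unfolding Lp_seminorm_def
proof (rule Minkowski_integral[OF p])
  show "integrable (lebesgue_on {0..1}) (\<lambda>t. q (\<gamma> t - \<eta> t) powr p)"
    "integrable (lebesgue_on {0..1}) (\<lambda>t. q (\<eta> t - \<zeta> t) powr p)"
    using Lp_functions_diff[OF p] L q by (auto simp: Lp_functions_iff)
  show "q (\<gamma> t - \<zeta> t) \<le> q (\<gamma> t - \<eta> t) + q (\<eta> t - \<zeta> t)" for t
    using seminorm_triangle[OF q, of "\<gamma> t - \<eta> t" "\<eta> t - \<zeta> t"] by simp
qed (simp_all add: seminorm_nonneg[OF q])

text \<open>Permits a change of representatives inside a class.\<close>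

lemma Lp_seminorm_cong_AE:
  assumes "continuous_seminorm q" "\<gamma> \<in> Lp_functions p" "\<eta> \<in> Lp_functions p"
    "AE t in lebesgue_on {0..1}. \<gamma> t = \<eta> t"
  shows "Lp_seminorm p q \<gamma> = Lp_seminorm p q \<eta>"
proof -
  have "(\<integral>t. q (\<gamma> t) powr p \<partial>lebesgue_on {0..1}) = (\<integral>t. q (\<eta> t) powr p \<partial>lebesgue_on {0..1})"
  proof (rule integral_cong_AE)
    have [measurable]: "(\<lambda>t. q (\<gamma> t)) \<in> borel_measurable (lebesgue_on {0..1})"
      "(\<lambda>t. q (\<eta> t)) \<in> borel_measurable (lebesgue_on {0..1})"
      using assms by (auto intro: seminorm_Lp_measurable)
    show "(\<lambda>t. q (\<gamma> t) powr p) \<in> borel_measurable (lebesgue_on {0..1})"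
      "(\<lambda>t. q (\<eta> t) powr p) \<in> borel_measurable (lebesgue_on {0..1})"
      by measurable
    show "AE t in lebesgue_on {0..1}. q (\<gamma> t) powr p = q (\<eta> t) powr p"
      using assms(4) by eventually_elim simp
  qed
  then show ?thesis
    by (simp add: Lp_seminorm_def)
qed

lemma Lp_seminorm_mono:
  assumes "1 \<le> p" "continuous_seminorm r" "\<gamma> \<in> Lp_functions p"
    and "\<And>x. 0 \<le> q x" "\<And>x. q x \<le> r x"
  shows "Lp_seminorm p q \<gamma> \<le> Lp_seminorm p r \<gamma>"
  unfolding Lp_seminorm_def
  by (intro powr_mono2 integral_mono') (use assms in \<open>auto simp: Lp_functions_iff intro: order_trans\<close>)

section \<open>Approximation by continuous functions\<close>

text \<open>Interpolation with a partition of unity: the weight \<open>max 0 (d s - dist t s)\<close> belongs to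
  the value at the node \<open>s\<close>, and the weight \<open>infdist t K\<close>, which vanishes on \<open>K\<close>, to the
  value \<open>0\<close>.\<close>

lemma continuous_interpolation:
  fixes \<gamma> :: "'b::metric_space \<Rightarrow> 'a::locally_convex_space"
  assumes q: "continuous_seminorm q" and K: "compact K" and \<gamma>: "continuous_on K \<gamma>"
    and e: "0 < e" and N: "0 \<le> N" "\<And>t. t \<in> K \<Longrightarrow> q (\<gamma> t) \<le> N"
  obtains \<eta> where "continuous_on UNIV \<eta>" "\<And>t. t \<in> K \<Longrightarrow> q (\<eta> t - \<gamma> t) \<le> e" "\<And>t. q (\<eta> t) \<le> N"
proof (cases "K = {}")
  case True
  then show ?thesis
    \<comment> \<open>\<open>infdist t {}\<close> is 0 by convention, so the total weight would
      vanish for empty \<open>K\<close>; the zero function serves instead.\<close>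
    using that[of "\<lambda>_. 0"] N by (simp add: seminorm_zero[OF q])
next
  case False
  have "\<exists>d>0. \<forall>t\<in>K. dist t s < d \<longrightarrow> q (\<gamma> s - \<gamma> t) < e" if s: "s \<in> K" for s
  proof -
    have "continuous_on K (\<lambda>t. q (\<gamma> s - \<gamma> t))"
      using \<gamma> by (intro continuous_on_seminorm[OF q] continuous_on_diff continuous_on_const)
    with s e obtain d where d: "d > 0"
      "\<forall>t\<in>K. dist t s < d \<longrightarrow> dist (q (\<gamma> s - \<gamma> t)) (q (\<gamma> s - \<gamma> s)) < e"
      unfolding continuous_on_iff by blast
    then show ?thesis
      by (intro exI[of _ d]) (auto simp: dist_real_def seminorm_zero[OF q] seminorm_nonneg[OF q])
  qed
  then obtain d where d: "\<And>s. s \<in> K \<Longrightarrow> 0 < d s"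
    "\<And>s t. s \<in> K \<Longrightarrow> t \<in> K \<Longrightarrow> dist t s < d s \<Longrightarrow> q (\<gamma> s - \<gamma> t) < e"
    by metis
  have "K \<subseteq> (\<Union>s\<in>K. ball s (d s))"
    using d(1) by force
  then obtain F where F: "F \<subseteq> K" "finite F" "K \<subseteq> (\<Union>s\<in>F. ball s (d s))"
    using compactE_image[OF K, of K "\<lambda>s. ball s (d s)"] by auto
  define w where "w s t = max 0 (d s - dist t s)" for s t
  define W where "W t = infdist t K + (\<Sum>s\<in>F. w s t)" for t
  define \<eta> where "\<eta> t = (\<Sum>s\<in>F. (w s t / W t) *\<^sub>R \<gamma> s)" for t
  have w_nonneg: "0 \<le> w s t" for s t
    by (simp add: w_def)
  \<comment> \<open>On \<open>K\<close> some ball around a node contains \<open>t\<close>; off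
    \<open>K\<close> the distance to the closed set \<open>K\<close> is positive.\<close>
  have W_pos: "0 < W t" for t
  proof (cases "t \<in> K")
    case True
    then obtain s where s: "s \<in> F" "dist t s < d s"
      using F(3) by (auto simp: dist_commute)
    then have "0 < (\<Sum>s\<in>F. w s t)"
      using F(2) w_nonneg by (intro sum_pos2[of F s]) (auto simp: w_def)
    then show ?thesis
      unfolding W_def by (intro add_nonneg_pos infdist_nonneg)
  next
    case False
    then have "0 < infdist t K"
      using K \<open>K \<noteq> {}\<close> by (simp add: compact_imp_closed infdist_pos_not_in_closed)
    then show ?thesis
      unfolding W_def using w_nonneg by (intro add_pos_nonneg sum_nonneg)
  qed
  have w_cont: "continuous_on UNIV (w s)" for s
    unfolding w_def by (intro continuous_intros)
  have "continuous_on UNIV W"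
    unfolding W_def by (intro continuous_intros w_cont)
  then have "continuous_on UNIV \<eta>"
    unfolding \<eta>_def using W_pos
    by (intro continuous_on_sum continuous_on_scaleR_tvs continuous_on_divide w_cont)
      (auto simp: less_imp_neq[symmetric])
  moreover have "q (\<eta> t - \<gamma> t) \<le> e" if t: "t \<in> K" for t
  proof -
    \<comment> \<open>On \<open>K\<close> the normalised node weights sum to 1, so
      \<open>\<eta> t - \<gamma> t\<close> is a convex combination of the
      \<open>\<gamma> s - \<gamma> t\<close>. Only nodes with \<open>dist t s < d s\<close> have
      nonzero weight, and for these the seminorm is below \<open>e\<close>.\<close>
    have "infdist t K = 0"
      using t by simp
    then have W: "(\<Sum>s\<in>F. w s t / W t) = 1"
      using W_pos[of t] by (simp add: W_def sum_divide_distrib[symmetric])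
    then have "\<gamma> t = (\<Sum>s\<in>F. (w s t / W t) *\<^sub>R \<gamma> t)"
      by (simp flip: scaleR_left.sum)
    then have "\<eta> t - \<gamma> t = (\<Sum>s\<in>F. (w s t / W t) *\<^sub>R (\<gamma> s - \<gamma> t))"
      by (simp add: \<eta>_def scaleR_diff_right sum_subtractf)
    then have "q (\<eta> t - \<gamma> t) \<le> (\<Sum>s\<in>F. q ((w s t / W t) *\<^sub>R (\<gamma> s - \<gamma> t)))"
      by (simp add: seminorm_sum[OF q])
    also have "\<dots> = (\<Sum>s\<in>F. w s t / W t * q (\<gamma> s - \<gamma> t))"
      using w_nonneg W_pos by (simp add: seminorm_scaleR[OF q] less_imp_le)
    also have "\<dots> \<le> (\<Sum>s\<in>F. w s t / W t * e)"
    proof (intro sum_mono)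
      fix s assume s: "s \<in> F"
      show "w s t / W t * q (\<gamma> s - \<gamma> t) \<le> w s t / W t * e"
      proof (cases "dist t s < d s")
        case True
        then show ?thesis
          using d(2)[of s t] s t F(1) w_nonneg[of s t] W_pos[of t]
          by (intro mult_left_mono) auto
      next
        case False
        then show ?thesis
          by (simp add: w_def)
      qed
    qed
    also have "\<dots> = (\<Sum>s\<in>F. w s t / W t) * e"
      by (rule sum_distrib_right[symmetric])
    also have "\<dots> = e"
      using W by simp
    finally show ?thesis .
  qed
  moreover have "q (\<eta> t) \<le> N" for t
  proof -
    have "q (\<eta> t) \<le> (\<Sum>s\<in>F. q ((w s t / W t) *\<^sub>R \<gamma> s))"
      unfolding \<eta>_def by (rule seminorm_sum[OF q])
    also have "\<dots> = (\<Sum>s\<in>F. w s t / W t * q (\<gamma> s))"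
      using w_nonneg W_pos by (simp add: seminorm_scaleR[OF q] less_imp_le)
    also have "\<dots> \<le> (\<Sum>s\<in>F. w s t / W t * N)"
      using N F w_nonneg W_pos by (intro sum_mono mult_left_mono) (auto simp: less_imp_le)
    also have "\<dots> = (\<Sum>s\<in>F. w s t) / W t * N"
      by (simp add: sum_divide_distrib sum_distrib_right)
    \<comment> \<open>The distance term in \<open>W\<close> is nonnegative, so the normalised node
      weights sum to at most 1, also off \<open>K\<close>.\<close>
    also have "\<dots> \<le> 1 * N"
      using N W_pos[of t] by (intro mult_right_mono) (auto simp: W_def infdist_nonneg)
    finally show ?thesis
      by simp
  qed
  ultimately show ?thesis
    using that by blast
qed

text \<open>The truncations differ from \<open>\<gamma>\<close> by at most
  \<open>q (\<gamma> t)\<close> in the seminorm \<open>q\<close> and converge pointwise, so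
  dominated convergence applies.\<close>

lemma Lp_truncation:
  fixes \<gamma> :: "real \<Rightarrow> 'a::locally_convex_space"
  assumes p: "1 \<le> p" and q: "continuous_seminorm q" and \<gamma>: "\<gamma> \<in> Lp_functions p" and e: "0 < e"
  obtains \<eta> N where "\<eta> \<in> Lp_functions p" "0 < N" "\<And>t. q (\<eta> t) \<le> N"
    "Lp_seminorm p q (\<lambda>t. \<eta> t - \<gamma> t) < e"
proof -
  \<comment> \<open>\<open>Suc n\<close> rather than \<open>n\<close> keeps the denominator
    positive, hence \<open>c n\<close> continuous, at points where \<open>q\<close>
    vanishes.\<close>
  define c where "c n x = real (Suc n) / max (real (Suc n)) (q x)" for n x
  define \<eta> where "\<eta> n t = c n (\<gamma> t) *\<^sub>R \<gamma> t" for n t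
  have c: "0 \<le> c n x" "c n x \<le> 1" "c n x * q x \<le> Suc n" for n x
    by (auto simp: c_def divide_le_eq max_def field_simps simp del: of_nat_Suc)
  have c_cont: "continuous_on UNIV (c n)" for n
    unfolding c_def by (intro continuous_intros continuous_on_seminorm[OF q]) auto
  have \<eta>_Lp: "\<eta> n \<in> Lp_functions p" for n
  proof (rule Lp_functions_dominated)
    show "Lusin_measurable (\<eta> n)"
      unfolding \<eta>_def
    proof (rule Lusin_measurable_compose[of \<gamma> "\<lambda>x. c n x *\<^sub>R x"])
      show "continuous_on UNIV (\<lambda>x. c n x *\<^sub>R x)"
        by (intro continuous_on_scaleR_tvs c_cont continuous_on_id)
    qed (use \<gamma> in \<open>simp add: Lp_functions_iff\<close>)
    fix r :: "'a \<Rightarrow> real" assume r: "continuous_seminorm r"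
    \<comment> \<open>Although built from \<open>q\<close>, the factor lies between 0 and 1 and
      therefore shrinks every seminorm.\<close>
    have "r (\<eta> n t) powr p \<le> r (\<gamma> t) powr p" for t
      using p c[of n "\<gamma> t"] seminorm_nonneg[OF r, of "\<gamma> t"]
      by (intro powr_mono2) (auto simp: \<eta>_def seminorm_scaleR[OF r] mult_left_le_one_le)
    then show "\<exists>g. integrable (lebesgue_on {0..1}) g \<and> (\<forall>t\<in>{0..1}. r (\<eta> n t) powr p \<le> g t)"
      using \<gamma> r by (auto simp: Lp_functions_iff)
  qed
  have q_diff: "q (\<eta> n t - \<gamma> t) = (1 - c n (\<gamma> t)) * q (\<gamma> t)" for n t
  proof -
    have "\<eta> n t - \<gamma> t = (c n (\<gamma> t) - 1) *\<^sub>R \<gamma> t"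
      by (simp add: \<eta>_def algebra_simps)
    then show ?thesis
      using c(2)[of n "\<gamma> t"] by (simp add: seminorm_scaleR[OF q])
  qed
  have "(\<lambda>n. \<integral>t. q (\<eta> n t - \<gamma> t) powr p \<partial>lebesgue_on {0..1})
      \<longlonglongrightarrow> (\<integral>t. 0 \<partial>lebesgue_on {0..1::real})"
  proof (rule integral_dominated_convergence)
    show "integrable (lebesgue_on {0..1}) (\<lambda>t. q (\<gamma> t) powr p)"
      using \<gamma> q by (simp add: Lp_functions_iff)
    show "(\<lambda>t. q (\<eta> n t - \<gamma> t) powr p) \<in> borel_measurable (lebesgue_on {0..1})" for n
    proof -
      have [measurable]: "(\<lambda>t. q (\<eta> n t - \<gamma> t)) \<in> borel_measurable (lebesgue_on {0..1})"
        using seminorm_Lp_measurable[OF Lp_functions_diff[OF p \<eta>_Lp \<gamma>] q] .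
      show ?thesis
        by measurable
    qed
    \<comment> \<open>As soon as \<open>q (\<gamma> t) \<le> n\<close>, the truncation leaves
      \<open>\<gamma> t\<close> unchanged, so the sequence is eventually equal to 0.\<close>
    have "(\<lambda>n. q (\<eta> n t - \<gamma> t) powr p) \<longlonglongrightarrow> 0" for t
    proof (rule tendsto_eventually)
      have "eventually (\<lambda>n. q (\<gamma> t) \<le> real n) sequentially"
        using filterlim_real_sequentially by (simp add: filterlim_at_top)
      then show "eventually (\<lambda>n. q (\<eta> n t - \<gamma> t) powr p = 0) sequentially"
        by eventually_elim (auto simp: q_diff c_def max_def)
    qed
    then show "AE t in lebesgue_on {0..1}. (\<lambda>n. q (\<eta> n t - \<gamma> t) powr p) \<longlonglongrightarrow> 0"
      by simp
    have "q (\<eta> n t - \<gamma> t) powr p \<le> q (\<gamma> t) powr p" for n t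
      using p c[of n "\<gamma> t"] seminorm_nonneg[OF q, of "\<gamma> t"]
      by (intro powr_mono2) (auto simp: q_diff mult_left_le_one_le)
    then show "AE t in lebesgue_on {0..1}. norm (q (\<eta> n t - \<gamma> t) powr p) \<le> q (\<gamma> t) powr p" for n
      by simp
  qed simp
  then have "(\<lambda>n. \<integral>t. q (\<eta> n t - \<gamma> t) powr p \<partial>lebesgue_on {0..1}) \<longlonglongrightarrow> 0"
    by simp
  then have "eventually (\<lambda>n. (\<integral>t. q (\<eta> n t - \<gamma> t) powr p \<partial>lebesgue_on {0..1}) < e powr p) sequentially"
    using e by (intro order_tendstoD) auto
  then obtain n where n: "(\<integral>t. q (\<eta> n t - \<gamma> t) powr p \<partial>lebesgue_on {0..1}) < e powr p"
    by (auto simp: eventually_sequentially)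
  have "Lp_seminorm p q (\<lambda>t. \<eta> n t - \<gamma> t) < (e powr p) powr (1 / p)"
    unfolding Lp_seminorm_def using p n by (intro powr_less_mono2) (auto intro: integral_nonneg_AE)
  also have "\<dots> = e"
    using p e by (simp add: powr_powr)
  finally have "Lp_seminorm p q (\<lambda>t. \<eta> n t - \<gamma> t) < e" .
  moreover have "q (\<eta> n t) \<le> real (Suc n)" for t
    using c[of n "\<gamma> t"] by (simp add: \<eta>_def seminorm_scaleR[OF q])
  ultimately show ?thesis
    using that[of "\<eta> n" "real (Suc n)"] \<eta>_Lp by auto
qed

text \<open>The error is at most \<open>e'\<close> on \<open>K\<close> and, by the two bounds
  \<open>N\<close>, at most \<open>2 * N\<close> on the small complement of
  \<open>K\<close>.\<close>

lemma Lp_continuous_approx_bounded: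
  fixes \<gamma> :: "real \<Rightarrow> 'a::locally_convex_space"
  assumes p: "1 \<le> p" and q: "continuous_seminorm q" and \<gamma>: "Lusin_measurable \<gamma>"
    and N: "0 < N" "\<And>t. q (\<gamma> t) \<le> N" and e: "0 < e"
  obtains \<eta> where "continuous_on UNIV \<eta>" "Lp_seminorm p q (\<lambda>t. \<eta> t - \<gamma> t) < e"
proof -
  \<comment> \<open>\<open>K\<close> and its complement each contribute at most a third of
    \<open>e powr p\<close>: \<open>e' powr p\<close> and \<open>(2 * N) powr p * \<delta>\<close>
    both equal that third. Thirds instead of halves make the final inequality strict.\<close>
  define \<delta> where "\<delta> = e powr p / 3 / (2 * N) powr p"
  define e' where "e' = (e powr p / 3) powr (1 / p)"
  have pos: "0 < \<delta>" "0 < e'"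
    using e N by (auto simp: \<delta>_def e'_def)
  obtain K where K: "compact K" "K \<subseteq> {0..1}" "emeasure lebesgue ({0..1} - K) \<le> ennreal \<delta>"
    "continuous_on K \<gamma>"
    using Lusin_measurableE[OF \<gamma> pos(1)] .
  obtain \<eta> where \<eta>: "continuous_on UNIV \<eta>" "\<And>t. t \<in> K \<Longrightarrow> q (\<eta> t - \<gamma> t) \<le> e'" "\<And>t. q (\<eta> t) \<le> N"
    using continuous_interpolation[OF q K(1,4) pos(2) less_imp_le[OF N(1)] N(2)] by blast
  let ?M = "lebesgue_on {0..1::real}"
  let ?A = "{0..1} - K"
  have A: "?A \<in> sets lebesgue"
    using K by (auto simp: compact_imp_closed)
  then have A_sets: "?A \<in> sets ?M"
    by (auto simp: sets_restrict_space_iff)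
  have A_measure: "measure ?M ?A \<le> \<delta>"
    using K(3) pos A by (auto simp: measure_restrict_space measure_def emeasure_restrict_space
        intro: enn2real_leI)
  interpret finite_measure ?M
    by (rule finite_measure_lebesgue_on) auto
  have A_integrable: "integrable ?M (indicator ?A :: real \<Rightarrow> real)"
    using A_sets by (intro integrable_real_indicator) (auto simp: less_top[symmetric])
  have "(\<integral>t. q (\<eta> t - \<gamma> t) powr p \<partial>?M) \<le> (\<integral>t. e' powr p + (2 * N) powr p * indicator ?A t \<partial>?M)"
  proof (rule integral_mono')
    show "integrable ?M (\<lambda>t. e' powr p + (2 * N) powr p * indicator ?A t)"
      using A_integrable by simp
    fix t assume t: "t \<in> space ?M"
    show "q (\<eta> t - \<gamma> t) powr p \<le> e' powr p + (2 * N) powr p * indicator ?A t"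
    proof (cases "t \<in> K")
      case True
      then show ?thesis
        using \<eta>(2)[OF True] p by (auto intro!: powr_mono2 simp: seminorm_nonneg[OF q])
    next
      case False
      have "q (\<eta> t - \<gamma> t) \<le> 2 * N"
        using seminorm_diff_le[OF q, of "\<eta> t" "\<gamma> t"] \<eta>(3)[of t] N(2)[of t] by simp
      then have "q (\<eta> t - \<gamma> t) powr p \<le> (2 * N) powr p"
        using p by (intro powr_mono2) (auto simp: seminorm_nonneg[OF q])
      then show ?thesis
        using False t by (simp add: add_increasing)
    qed
  qed simp
  also have "\<dots> = e' powr p * measure ?M {0..1} + (2 * N) powr p * measure ?M ?A"
    using A_sets A_integrable by (simp add: Int_absorb2)
  also have "\<dots> \<le> e powr p / 3 + (2 * N) powr p * \<delta>"
    using A_measure p by (intro add_mono mult_left_mono)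
      (auto simp: measure_restrict_space e'_def powr_powr)
  also have "\<dots> < e powr p"
    using e N by (simp add: \<delta>_def)
  finally have "(\<integral>t. q (\<eta> t - \<gamma> t) powr p \<partial>?M) < e powr p" .
  then have "Lp_seminorm p q (\<lambda>t. \<eta> t - \<gamma> t) < (e powr p) powr (1 / p)"
    unfolding Lp_seminorm_def using p by (intro powr_less_mono2) (auto intro: integral_nonneg_AE)
  also have "\<dots> = e"
    using p e by (simp add: powr_powr)
  finally show ?thesis
    using that \<eta>(1) by blast
qed

lemma Lp_continuous_approx:
  fixes \<gamma> :: "real \<Rightarrow> 'a::locally_convex_space"
  assumes p: "1 \<le> p" and q: "continuous_seminorm q" and \<gamma>: "\<gamma> \<in> Lp_functions p" and e: "0 < e"
  obtains \<eta> where "continuous_on {0..1} \<eta>" "Lp_seminorm p q (\<lambda>t. \<eta> t - \<gamma> t) < e"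
proof -
  have e2: "0 < e / 2"
    using e by simp
  obtain \<zeta> N where \<zeta>: "\<zeta> \<in> Lp_functions p" "0 < N" "\<And>t. q (\<zeta> t) \<le> N"
    "Lp_seminorm p q (\<lambda>t. \<zeta> t - \<gamma> t) < e / 2"
    using Lp_truncation[OF p q \<gamma> e2] by blast
  have \<zeta>_Lusin: "Lusin_measurable \<zeta>"
    using \<zeta>(1) by (simp add: Lp_functions_iff)
  obtain \<eta> where \<eta>: "continuous_on UNIV \<eta>" "Lp_seminorm p q (\<lambda>t. \<eta> t - \<zeta> t) < e / 2"
    using Lp_continuous_approx_bounded[OF p q \<zeta>_Lusin \<zeta>(2,3) e2] by blast
  have cont: "continuous_on {0..1} \<eta>"
    using \<eta>(1) by (rule continuous_on_subset) simp
  have "Lp_seminorm p q (\<lambda>t. \<eta> t - \<gamma> t) < e"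
    using Lp_seminorm_triangle[OF p q continuous_imp_Lp_functions[OF p cont] \<zeta>(1) \<gamma>] \<zeta>(4) \<eta>(2)
    by simp
  with cont show ?thesis
    using that by blast
qed

section \<open>The topology of \<open>Lp_space\<close>\<close>

lemma Lp_space_representatives:
  assumes "X \<in> Lp_space p" "\<gamma> \<in> X"
  shows "\<gamma> \<in> Lp_functions p"
    and "\<eta> \<in> X \<Longrightarrow> AE t in lebesgue_on {0..1}. \<gamma> t = \<eta> t"
proof -
  show "\<gamma> \<in> Lp_functions p"
    using assms in_quotient_imp_subset[OF equiv_Lp_rel] unfolding Lp_space_def by blast
  show "AE t in lebesgue_on {0..1}. \<gamma> t = \<eta> t" if "\<eta> \<in> X"
    using assms that quotient_eq_iff[OF equiv_Lp_rel, of X p X \<gamma> \<eta>]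
    unfolding Lp_space_def by (simp add: Lp_rel_def)
qed

text \<open>Induction on the generation of the topology. The generating balls may be centred
  anywhere, so they are recentred at \<open>X\<close> by the triangle inequality.\<close>

lemma openin_Lp_topology_contains_ball:
  fixes X :: "(real \<Rightarrow> 'a::locally_convex_space) set"
  assumes p: "1 \<le> p" and "openin (Lp_topology p) V" "X \<in> V" "X \<in> Lp_space p"
  shows "\<exists>q \<epsilon>. continuous_seminorm q \<and> 0 < \<epsilon> \<and> Lp_ball p q X \<epsilon> \<subseteq> V"
proof -
  have "generate_topology_on {Lp_ball p q X \<epsilon> | (q :: 'a \<Rightarrow> real) X \<epsilon>.
      continuous_seminorm q \<and> X \<in> Lp_space p \<and> \<epsilon> > 0} V"
    using assms(2) by (simp add: Lp_topology_def openin_topology_generated_by_iff)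
  then show ?thesis
    using \<open>X \<in> V\<close>
  proof induction
    case (Int A B)
    then obtain q r \<epsilon> \<delta> where q: "continuous_seminorm q" "0 < \<epsilon>" "Lp_ball p q X \<epsilon> \<subseteq> A"
      and r: "continuous_seminorm r" "0 < \<delta>" "Lp_ball p r X \<delta> \<subseteq> B"
      by blast
    \<comment> \<open>Since \<open>q\<close> and \<open>r\<close> are both bounded by their sum, a
      small ball for the sum lies in both given balls.\<close>
    let ?s = "\<lambda>x. q x + r x"
    have s: "continuous_seminorm ?s"
      using q(1) r(1) by (rule continuous_seminorm_add)
    have "Y \<in> Lp_ball p q X \<epsilon> \<inter> Lp_ball p r X \<delta>" if Y: "Y \<in> Lp_ball p ?s X (min \<epsilon> \<delta>)" for Y
    proof -
      obtain \<gamma> \<eta> where *: "Y \<in> Lp_space p" "\<gamma> \<in> X" "\<eta> \<in> Y"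
        "Lp_seminorm p ?s (\<lambda>t. \<eta> t - \<gamma> t) < min \<epsilon> \<delta>"
        using Y by (auto simp: Lp_ball_def)
      have L: "(\<lambda>t. \<eta> t - \<gamma> t) \<in> Lp_functions p"
        using * assms(4) by (intro Lp_functions_diff[OF p]) (auto intro: Lp_space_representatives(1))
      have "Lp_seminorm p q (\<lambda>t. \<eta> t - \<gamma> t) < \<epsilon>" "Lp_seminorm p r (\<lambda>t. \<eta> t - \<gamma> t) < \<delta>"
        using *(4) Lp_seminorm_mono[OF p s L, of q] Lp_seminorm_mono[OF p s L, of r]
          seminorm_nonneg[OF q(1)] seminorm_nonneg[OF r(1)] by auto
      then show ?thesis
        using * by (auto simp: Lp_ball_def)
    qed
    then have "Lp_ball p ?s X (min \<epsilon> \<delta>) \<subseteq> A \<inter> B"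
      using q(3) r(3) by blast
    then show ?case
      using s q(2) r(2) by (intro exI[of _ ?s] exI[of _ "min \<epsilon> \<delta>"]) simp
  next
    case (UN \<K>)
    then show ?case
      by (meson Union_iff Union_upper order_trans)
  next
    case (Basis V)
    then obtain q Z \<epsilon> where V: "V = Lp_ball p q Z \<epsilon>" "continuous_seminorm q" "Z \<in> Lp_space p"
      by blast
    with Basis obtain \<zeta> \<xi> where *: "\<zeta> \<in> Z" "\<xi> \<in> X" "Lp_seminorm p q (\<lambda>t. \<xi> t - \<zeta> t) < \<epsilon>"
      by (auto simp: Lp_ball_def)
    \<comment> \<open>The slack left between \<open>X\<close> and the boundary of the ball around
      \<open>Z\<close>; it is positive because \<open>X\<close> lies in that ball.\<close>
    let ?d = "\<epsilon> - Lp_seminorm p q (\<lambda>t. \<xi> t - \<zeta> t)"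
    have "Y \<in> V" if Y: "Y \<in> Lp_ball p q X ?d" for Y
    proof -
      obtain \<gamma> \<eta> where Y': "Y \<in> Lp_space p" "\<gamma> \<in> X" "\<eta> \<in> Y"
        "Lp_seminorm p q (\<lambda>t. \<eta> t - \<gamma> t) < ?d"
        using Y by (auto simp: Lp_ball_def)
      have L: "\<zeta> \<in> Lp_functions p" "\<xi> \<in> Lp_functions p" "\<gamma> \<in> Lp_functions p" "\<eta> \<in> Lp_functions p"
        using Y' V * assms(4) by (auto intro: Lp_space_representatives(1))
      \<comment> \<open>The two balls may be witnessed by different representatives
        \<open>\<gamma>\<close> and \<open>\<xi>\<close> of \<open>X\<close>; these agree almost
        everywhere.\<close>
      have "AE t in lebesgue_on {0..1}. \<gamma> t - \<zeta> t = \<xi> t - \<zeta> t"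
        using Lp_space_representatives(2)[OF assms(4) Y'(2) *(2)] by eventually_elim simp
      then have "Lp_seminorm p q (\<lambda>t. \<gamma> t - \<zeta> t) = Lp_seminorm p q (\<lambda>t. \<xi> t - \<zeta> t)"
        using L by (intro Lp_seminorm_cong_AE V Lp_functions_diff[OF p])
      then have "Lp_seminorm p q (\<lambda>t. \<eta> t - \<zeta> t) < \<epsilon>"
        using Lp_seminorm_triangle[OF p V(2) L(4,3,1)] Y'(4) by simp
      then show ?thesis
        using Y' * V by (auto simp: Lp_ball_def)
    qed
    then show ?case
      using V(2) *(3) by (intro exI[of _ q] exI[of _ ?d]) auto
  qed simp
qed

section \<open>Density of the continuous functions\<close>

theorem theorem3p7:
  fixes p :: real
  assumes "1 \<le> p"
  shows "(continuous_classes p :: (real \<Rightarrow> 'a::{locally_convex_space,t2_space}) set set)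
           \<subseteq> Lp_space p \<and>
         Lp_topology p closure_of
             (continuous_classes p :: (real \<Rightarrow> 'a) set set) = Lp_space p"
proof (intro conjI)
  show classes: "(continuous_classes p :: (real \<Rightarrow> 'a) set set) \<subseteq> Lp_space p"
    unfolding continuous_classes_def Lp_space_def
    using continuous_imp_Lp_functions[OF assms] by (auto intro: quotientI)
  show "Lp_topology p closure_of (continuous_classes p :: (real \<Rightarrow> 'a) set set) = Lp_space p"
  proof
    show "Lp_topology p closure_of continuous_classes p \<subseteq> (Lp_space p :: (real \<Rightarrow> 'a) set set)"
      using closure_of_subset_topspace topspace_Lp_topology by metis
    show "(Lp_space p :: (real \<Rightarrow> 'a) set set) \<subseteq> Lp_topology p closure_of continuous_classes p"
    proof
      fix X :: "(real \<Rightarrow> 'a) set" assume X: "X \<in> Lp_space p"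
      then obtain \<gamma> where \<gamma>: "\<gamma> \<in> X"
        using equiv_Lp_rel in_quotient_imp_non_empty unfolding Lp_space_def by blast
      have "\<exists>Y. Y \<in> continuous_classes p \<and> Y \<in> V"
        if V: "X \<in> V" "openin (Lp_topology p) V" for V
      proof -
        obtain q \<epsilon> where q: "continuous_seminorm q" "0 < \<epsilon>" "Lp_ball p q X \<epsilon> \<subseteq> V"
          using openin_Lp_topology_contains_ball[OF assms V(2,1) X] by blast
        obtain \<eta> where \<eta>: "continuous_on {0..1} \<eta>" "Lp_seminorm p q (\<lambda>t. \<eta> t - \<gamma> t) < \<epsilon>"
          using Lp_continuous_approx[OF assms q(1) Lp_space_representatives(1)[OF X \<gamma>] q(2)] .
        let ?Y = "Lp_rel p `` {\<eta>}"
        have Y: "?Y \<in> continuous_classes p"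
          using \<eta>(1) by (auto simp: continuous_classes_def)
        \<comment> \<open>Continuous functions belong to \<open>Lp_functions p\<close>, so
          reflexivity puts \<open>\<eta>\<close> in its own class; \<open>\<gamma>\<close> and
          \<open>\<eta>\<close> then witness membership in the ball.\<close>
        moreover have "\<eta> \<in> ?Y"
          using equiv_class_self[OF equiv_Lp_rel] continuous_imp_Lp_functions[OF assms \<eta>(1)] .
        then have "?Y \<in> Lp_ball p q X \<epsilon>"
          using Y classes \<gamma> \<eta>(2) unfolding Lp_ball_def by blast
        ultimately show ?thesis
          using q(3) by blast
      qed
      then show "X \<in> Lp_topology p closure_of continuous_classes p"
        using X by (auto simp: in_closure_of topspace_Lp_topology)
    qed
  qed
qed

end
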